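(* (i) Let $G=(V,w,m)$ be a graph with a fixed vertex $x_0\in V$. If the sphere curvatures with respect to $x_0$ satisfy $$\kappa(r)\ge-C\log r$$ for some constant $C>0$ and all large $r$, then $G$ is stochastically complete. (ii) For $\varepsilon>0$, let $G_\varepsilon=(\mathbb N_0,w,m)$ be the birth-death chain with $m\equiv1$ and $$w(R,R+1)=1+\sum_{r=1}^R\sum_{k=1}^r(\log k)^{1+\varepsilon}\qquad(R\ge0).$$ Then $G_\varepsilon$ is stochastically incomplete (i.e. not stochastically complete) and its sphere curvatures with respect to the vertex $0$ satisfy $$\kappa(r)\ge-(\log r)^{1+\varepsilon}$$ for all $r\ge2$.
   Context: A graph is a triple $G=(V,w,m)$ with $V$ a countable set, $w:V\times V\to[0,\infty)$ symmetric and zero on the diagonal, and $m:V\to(0,\infty)$. Write $x\sim y$ if $w(x,y)>0$. All graphs are locally finite (for each $x$ only finitely many $y$ satisfy $x\sim y$) and connected; $d(x,y)=\inf\{n: x=x_0\sim\cdots\sim x_n=y\}$ is the combinatorial distance, which is finite by connectedness. A birth-death chain is a graph $(\mathbb N_0,w,m)$ with $w(k,n)=0$ whenever $|k-n|\neq1$. The Laplacian is $\Delta f(x)=\frac1{m(x)}\sum_{y\in V}w(x,y)(f(y)-f(x))$, and $\mathrm{Deg}(x)=\frac1{m(x)}\sum_{y}w(x,y)$. $Lip(1)$ is the set of $f:V\to\mathbb R$ with $|f(x)-f(y)|\le d(x,y)$ for all $x,y$. Heat semigroup: for non-negative bounded $f:V\to\mathbb R$, $P_tf(x)=u(x,t)$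 is the smallest non-negative bounded continuous solution of $\partial_tu=\Delta u$ on $V\times[0,\infty)$, $u(\cdot,0)=f$. $G$ is stochastically complete if $P_t\mathbf 1=\mathbf 1$ for all $t>0$, where $\mathbf 1$ is the constant function $1$. Curvature: for $x\in V$ and $\varepsilon>0$ let $m_x^\varepsilon(x)=1-\varepsilon\,\mathrm{Deg}(x)$ and $m_x^\varepsilon(y)=\varepsilon w(x,y)/m(x)$ for $y\neq x$; this is a finitely supported probability measure for $\varepsilon$ small. For probability measures $\mu,\nu$ on $V$, $W(\mu,\nu)=\sup_{f}\sum_{x}f(x)(\mu(x)-\nu(x))$, the supremum over bounded $f\in Lip(1)$. For $x\neq y$ let $\kappa_\varepsilon(x,y)=1-\frac{W(m_x^\varepsilon,m_y^\varepsilon)}{d(x,y)}$ and $\kappa(x,y)=\lim_{\varepsilon\to0^+}\frac1\varepsilon\kappa_\varepsilon(x,y)$ (this limit exists). Sphere curvatures with respect to $x_0$: with $S_r=\{y: d(x_0,y)=r\}$, for $r\ge1$, $\kappa(r)=\min_{y\in S_r}\max_{x\in S_{r-1},\,x\sim y}\kappa(x,y)$ (with value $+\infty$ if $S_r=\emptyset$). *)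

theory Defs
  imports "HOL-Analysis.Analysis"
begin

text \<open>
  The vertex set is the whole (countable) type \<open>'v\<close>. All graphs are locally finite, so every sum
  \<open>\<Sum>\<^sub>\<infinity>\<close> below that is weighted by \<open>w x\<close> or by the measures \<open>rw_measure\<close> has finite support.
\<close>

definition adj :: "('v \<Rightarrow> 'v \<Rightarrow> real) \<Rightarrow> 'v \<Rightarrow> 'v \<Rightarrow> bool" where
  "adj w x y \<longleftrightarrow> w x y > 0"

locale weighted_graph =
  fixes w :: "'v::countable \<Rightarrow> 'v \<Rightarrow> real"
    and m :: "'v \<Rightarrow> real"
  assumes w_nonneg: "w x y \<ge> 0"
    and w_sym: "w x y = w y x"
    and w_diag: "w x x = 0"
    and m_pos: "m x > 0"
    and locally_finite: "finite {y. adj w x y}"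
    and connected: "(adj w)\<^sup>*\<^sup>* x y"

locale birth_death_chain = weighted_graph w m
  for w :: "nat \<Rightarrow> nat \<Rightarrow> real" and m :: "nat \<Rightarrow> real" +
  assumes w_eq_0: "\<bar>int k - int n\<bar> \<noteq> 1 \<Longrightarrow> w k n = 0"

definition gdist :: "('v \<Rightarrow> 'v \<Rightarrow> real) \<Rightarrow> 'v \<Rightarrow> 'v \<Rightarrow> nat" where
  "gdist w x y = Inf {n. (adj w ^^ n) x y}"

definition Lip1 :: "('v \<Rightarrow> 'v \<Rightarrow> real) \<Rightarrow> ('v \<Rightarrow> real) set" where
  "Lip1 w = {f. \<forall>x y. \<bar>f x - f y\<bar> \<le> real (gdist w x y)}"

definition laplacian ::
    "('v \<Rightarrow> 'v \<Rightarrow> real) \<Rightarrow> ('v \<Rightarrow> real) \<Rightarrow> ('v \<Rightarrow> real) \<Rightarrow> 'v \<Rightarrow> real" where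
  "laplacian w m f x = (1 / m x) * (\<Sum>\<^sub>\<infinity>y. w x y * (f y - f x))"

definition Deg :: "('v \<Rightarrow> 'v \<Rightarrow> real) \<Rightarrow> ('v \<Rightarrow> real) \<Rightarrow> 'v \<Rightarrow> real" where
  "Deg w m x = (1 / m x) * (\<Sum>\<^sub>\<infinity>y. w x y)"


subsection \<open>Heat semigroup and stochastic completeness\<close>

text \<open>
  Solutions live on \<open>'v \<times> [0,\<infinity>)\<close>; values of \<open>u x t\<close> at \<open>t < 0\<close> are irrelevant. The time derivative
  at \<open>0\<close> is one-sided.
\<close>

definition heat_solution ::
    "('v \<Rightarrow> 'v \<Rightarrow> real) \<Rightarrow> ('v \<Rightarrow> real) \<Rightarrow> ('v \<Rightarrow> real) \<Rightarrow> ('v \<Rightarrow> real \<Rightarrow> real) \<Rightarrow> bool" where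
  "heat_solution w m f u \<longleftrightarrow>
     (\<forall>x. \<forall>t\<ge>0. u x t \<ge> 0) \<and>
     (\<exists>B. \<forall>x. \<forall>t\<ge>0. u x t \<le> B) \<and>
     (\<forall>x. continuous_on {0..} (u x)) \<and>
     (\<forall>x. \<forall>t\<ge>0. (u x has_real_derivative laplacian w m (\<lambda>y. u y t) x) (at t within {0..})) \<and>
     (\<forall>x. u x 0 = f x)"

definition minimal_heat_solution ::
    "('v \<Rightarrow> 'v \<Rightarrow> real) \<Rightarrow> ('v \<Rightarrow> real) \<Rightarrow> ('v \<Rightarrow> real) \<Rightarrow> ('v \<Rightarrow> real \<Rightarrow> real) \<Rightarrow> bool" where
  "minimal_heat_solution w m f u \<longleftrightarrow>
     heat_solution w m f u \<and>
     (\<forall>v. heat_solution w m f v \<longrightarrow> (\<forall>x. \<forall>t\<ge>0. u x t \<le> v x t))"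

definition heat_semigroup ::
    "('v \<Rightarrow> 'v \<Rightarrow> real) \<Rightarrow> ('v \<Rightarrow> real) \<Rightarrow> real \<Rightarrow> ('v \<Rightarrow> real) \<Rightarrow> 'v \<Rightarrow> real" where
  "heat_semigroup w m t f x = (THE p. \<exists>u. minimal_heat_solution w m f u \<and> p = u x t)"

definition stochastically_complete ::
    "('v \<Rightarrow> 'v \<Rightarrow> real) \<Rightarrow> ('v \<Rightarrow> real) \<Rightarrow> bool" where
  "stochastically_complete w m \<longleftrightarrow> (\<forall>t>0. heat_semigroup w m t (\<lambda>_. 1) = (\<lambda>_. 1))"


subsection \<open>Curvature\<close>

text \<open>
  Measures on the vertices are given by their mass functions. \<open>rw_measure w m \<epsilon> x\<close> has total mass
  \<open>1\<close> for every \<open>\<epsilon>\<close>, but is non-negative only for small \<open>\<epsilon>\<close>, which is all that matters in the limit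
  defining \<open>curvature\<close>.
\<close>

definition rw_measure ::
    "('v \<Rightarrow> 'v \<Rightarrow> real) \<Rightarrow> ('v \<Rightarrow> real) \<Rightarrow> real \<Rightarrow> 'v \<Rightarrow> 'v \<Rightarrow> real" where
  "rw_measure w m \<epsilon> x y = (if y = x then 1 - \<epsilon> * Deg w m x else \<epsilon> * w x y / m x)"

definition wasserstein ::
    "('v \<Rightarrow> 'v \<Rightarrow> real) \<Rightarrow> ('v \<Rightarrow> real) \<Rightarrow> ('v \<Rightarrow> real) \<Rightarrow> real" where
  "wasserstein w \<mu> \<nu> =
     (SUP f\<in>{f \<in> Lip1 w. bounded (range f)}. \<Sum>\<^sub>\<infinity>x. f x * (\<mu> x - \<nu> x))"

definition curvature_eps ::
    "('v \<Rightarrow> 'v \<Rightarrow> real) \<Rightarrow> ('v \<Rightarrow> real) \<Rightarrow> real \<Rightarrow> 'v \<Rightarrow> 'v \<Rightarrow> real" where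
  "curvature_eps w m \<epsilon> x y =
     1 - wasserstein w (rw_measure w m \<epsilon> x) (rw_measure w m \<epsilon> y) / real (gdist w x y)"

definition curvature ::
    "('v \<Rightarrow> 'v \<Rightarrow> real) \<Rightarrow> ('v \<Rightarrow> real) \<Rightarrow> 'v \<Rightarrow> 'v \<Rightarrow> real" where
  "curvature w m x y = Lim (at_right 0) (\<lambda>\<epsilon>. (1 / \<epsilon>) * curvature_eps w m \<epsilon> x y)"

definition gsphere :: "('v \<Rightarrow> 'v \<Rightarrow> real) \<Rightarrow> 'v \<Rightarrow> nat \<Rightarrow> 'v set" where
  "gsphere w x0 r = {y. gdist w x0 y = r}"

text \<open>Only meaningful for \<open>r \<ge> 1\<close>.\<close>

definition sphere_curvature ::
    "('v \<Rightarrow> 'v \<Rightarrow> real) \<Rightarrow> ('v \<Rightarrow> real) \<Rightarrow> 'v \<Rightarrow> nat \<Rightarrow> ereal" where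
  "sphere_curvature w m x0 r =
     (if gsphere w x0 r = {} then \<infinity>
      else ereal (MIN y\<in>gsphere w x0 r.
                    MAX x\<in>{x \<in> gsphere w x0 (r - 1). adj w x y}. curvature w m x y))"


subsection \<open>The chain \<open>G\<^sub>\<epsilon>\<close>\<close>

definition chain_rate :: "real \<Rightarrow> nat \<Rightarrow> real" where
  "chain_rate \<epsilon> R = 1 + (\<Sum>r=1..R. \<Sum>k=1..r. ln (real k) powr (1 + \<epsilon>))"

definition chain_weight :: "real \<Rightarrow> nat \<Rightarrow> nat \<Rightarrow> real" where
  "chain_weight \<epsilon> j k =
     (if k = j + 1 then chain_rate \<epsilon> j else if j = k + 1 then chain_rate \<epsilon> k else 0)"

lemma chain_rate_pos: "chain_rate \<epsilon> R > 0"
  unfolding chain_rate_def by (intro add_pos_nonneg sum_nonneg) auto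

lemma birth_death_chain_chain_weight: "birth_death_chain (chain_weight \<epsilon>) (\<lambda>_. 1)"
proof
  have adj_iff: "adj (chain_weight \<epsilon>) j k \<longleftrightarrow> k = j + 1 \<or> j = k + 1" for j k
    using chain_rate_pos by (auto simp: adj_def chain_weight_def)
  fix x y :: nat
  show "chain_weight \<epsilon> x y \<ge> 0"
    using chain_rate_pos by (auto simp: chain_weight_def less_imp_le)
  show "chain_weight \<epsilon> x y = chain_weight \<epsilon> y x" "chain_weight \<epsilon> x x = 0" "(1::real) > 0"
    by (auto simp: chain_weight_def)
  show "finite {y. adj (chain_weight \<epsilon>) x y}"
    by (rule finite_subset[of _ "{..x + 1}"]) (auto simp: adj_iff)
  have up: "(adj (chain_weight \<epsilon>))\<^sup>*\<^sup>* 0 n" for n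
    by (induction n) (auto simp: adj_iff intro: rtranclp.rtrancl_into_rtrancl)
  have down: "(adj (chain_weight \<epsilon>))\<^sup>*\<^sup>* n 0" for n
    by (induction n) (auto simp: adj_iff intro: converse_rtranclp_into_rtranclp)
  show "(adj (chain_weight \<epsilon>))\<^sup>*\<^sup>* x y"
    using down up by (rule rtranclp_trans)
next
  fix k n :: nat
  assume "\<bar>int k - int n\<bar> \<noteq> 1"
  then show "chain_weight \<epsilon> k n = 0"
    by (auto simp: chain_weight_def)
qed

end

theory Submission
  imports Defs
begin

text \<open>
  (i) Testing the transport distance with \<open>- d(x\<^sub>0, \<cdot>)\<close> gives
  \<open>\<kappa>(x, y) \<le> \<Delta> d(x\<^sub>0, \<cdot>)(x) - \<Delta> d(x\<^sub>0, \<cdot>)(y)\<close> for \<open>x \<sim> y\<close> with \<open>y\<close> one step further from \<open>x\<^sub>0\<close>.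
  Summing along spheres, \<open>\<kappa>(r) \<ge> - C log r\<close> yields \<open>\<Delta> d(x\<^sub>0, \<cdot>) = O(r log r)\<close>, so that by concavity
  the exhaustion function \<open>log log (d(x\<^sub>0, \<cdot>) + 3)\<close> has Laplacian bounded above, and Khas'minskii's
  criterion applies.

  (ii) On the chain, \<open>\<Sum>(r + 1) / w(r, r + 1)\<close> converges because \<open>w(r, r + 1)\<close> grows like
  \<open>r\<^sup>2 (log r)\<^bsup>1 + \<epsilon>\<^esup>\<close>; this sum is a bounded function with Laplacian \<open>1\<close>, from which a heat
  solution dropping below \<open>1\<close> is obtained. The minimal solution, which lies below it, is the
  increasing limit of Feller's iteration of Duhamel's formula.
\<close>

section \<open>Laplacian and combinatorial distance\<close>

context weighted_graph
begin

lemma adj_sym: "adj w x y \<Longrightarrow> adj w y x"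
  by (simp add: adj_def w_sym)

lemma not_adj_self: "\<not> adj w x x"
  by (simp add: adj_def w_diag)

lemma w_eq_0_if_not_adj: "\<not> adj w x y \<Longrightarrow> w x y = 0"
  using w_nonneg[of x y] by (simp add: adj_def)

lemma infsum_w: "(\<Sum>\<^sub>\<infinity>y. w x y * g y) = (\<Sum>y | adj w x y. w x y * g y)"
proof -
  have "(\<Sum>\<^sub>\<infinity>y. w x y * g y) = (\<Sum>\<^sub>\<infinity>y\<in>{y. adj w x y}. w x y * g y)"
    by (rule infsum_cong_neutral) (auto simp: w_eq_0_if_not_adj)
  then show ?thesis
    using locally_finite by simp
qed

lemma laplacian_eq: "laplacian w m f x = (\<Sum>y | adj w x y. w x y * (f y - f x)) / m x"
  by (simp add: laplacian_def infsum_w)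

lemma Deg_eq: "Deg w m x = (\<Sum>y | adj w x y. w x y) / m x"
  using infsum_w[of x "\<lambda>_. 1"] by (simp add: Deg_def)

lemma Deg_nonneg: "Deg w m x \<ge> 0"
  using m_pos[of x] by (auto simp: Deg_eq intro!: divide_nonneg_nonneg sum_nonneg w_nonneg)

lemma laplacian_split:
  "laplacian w m f x = (\<Sum>y | adj w x y. w x y * f y) / m x - Deg w m x * f x"
  by (simp add: laplacian_eq Deg_eq algebra_simps sum_subtractf sum_distrib_left diff_divide_distrib)

lemma laplacian_mono:
  assumes "\<And>y. adj w x y \<Longrightarrow> f y - f x \<le> g y - g x"
  shows "laplacian w m f x \<le> laplacian w m g x"
  unfolding laplacian_eq using assms m_pos[of x]
  by (intro divide_right_mono sum_mono mult_left_mono w_nonneg) auto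

lemma laplacian_cong:
  assumes "\<And>y. adj w x y \<Longrightarrow> f y - f x = g y - g x"
  shows "laplacian w m f x = laplacian w m g x"
  using assms by (intro order_antisym laplacian_mono) auto

lemma laplacian_cmult: "laplacian w m (\<lambda>y. c * f y) x = c * laplacian w m f x"
proof -
  have "(\<Sum>y | adj w x y. w x y * (c * f y - c * f x)) = c * (\<Sum>y | adj w x y. w x y * (f y - f x))"
    by (subst sum_distrib_left, rule sum.cong) (auto simp: algebra_simps)
  then show ?thesis by (simp add: laplacian_eq)
qed

lemma laplacian_add:
  "laplacian w m (\<lambda>y. f y + g y) x = laplacian w m f x + laplacian w m g x"
proof -
  have "(\<Sum>y | adj w x y. w x y * (f y + g y - (f x + g x)))
      = (\<Sum>y | adj w x y. w x y * (f y - f x)) + (\<Sum>y | adj w x y. w x y * (g y - g x))"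
    by (subst sum.distrib [symmetric], rule sum.cong) (auto simp: algebra_simps)
  then show ?thesis by (simp add: laplacian_eq add_divide_distrib)
qed

lemma laplacian_const: "laplacian w m (\<lambda>y. c) x = 0"
  by (simp add: laplacian_eq)

lemma abs_laplacian_le:
  assumes "\<And>y. adj w x y \<Longrightarrow> \<bar>f y - f x\<bar> \<le> c"
  shows "\<bar>laplacian w m f x\<bar> \<le> c * Deg w m x"
proof -
  have "\<bar>\<Sum>y | adj w x y. w x y * (f y - f x)\<bar> \<le> (\<Sum>y | adj w x y. w x y * c)"
    using assms w_nonneg[of x] 
    by (intro order_trans[OF sum_abs] sum_mono) (auto simp: abs_mult intro!: mult_left_mono)
  then have "\<bar>\<Sum>y | adj w x y. w x y * (f y - f x)\<bar> / m x \<le> (\<Sum>y | adj w x y. w x y * c) / m x"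
    using m_pos[of x] by (intro divide_right_mono) auto
  then show ?thesis
    using m_pos[of x] by (simp add: laplacian_eq Deg_eq sum_distrib_left mult.commute)
qed

section \<open>Combinatorial distance, finite balls and Lipschitz functions\<close>

lemma gdist_le: "(adj w ^^ n) x y \<Longrightarrow> gdist w x y \<le> n"
  unfolding gdist_def by (rule wellorder_Inf_le1) simp

lemma gdist_path: "(adj w ^^ gdist w x y) x y"
proof -
  have "{n. (adj w ^^ n) x y} \<noteq> {}"
    using rtranclp_imp_relpowp[OF connected] by auto
  then show ?thesis
    unfolding gdist_def using Inf_nat_def1[of "{n. (adj w ^^ n) x y}"] by blast
qed

lemma gdist_triangle: "gdist w x z \<le> gdist w x y + gdist w y z"
proof (rule gdist_le)
  show "(adj w ^^ (gdist w x y + gdist w y z)) x z"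
    unfolding relpowp_add by (rule relcomppI[of _ _ y]) (rule gdist_path)+
qed

lemma gdist_sym: "gdist w x y = gdist w y x"
proof -
  have rev: "(adj w ^^ n) b a" if "(adj w ^^ n) a b" for n a b
    using that
  proof (induction n arbitrary: b)
    case (Suc n)
    then obtain c where "(adj w ^^ n) a c" "adj w c b"
      by (elim relpowp_Suc_E)
    then show ?case
      using relpowp_Suc_I2[OF adj_sym Suc.IH] by blast
  qed auto
  then show ?thesis
    using gdist_le[OF rev[OF gdist_path]] by (intro order_antisym)
qed

lemma gdist_self [simp]: "gdist w x x = 0"
  using gdist_le[of 0 x x] by simp

lemma gdist_eq_0_iff: "gdist w x y = 0 \<longleftrightarrow> x = y"
  using gdist_path[of x y] by auto

lemma gdist_adj_le: "adj w x y \<Longrightarrow> gdist w x y \<le> 1"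
  by (rule gdist_le) auto

lemma gdist_adj: "adj w x y \<Longrightarrow> gdist w x y = 1"
  using gdist_adj_le[of x y] gdist_eq_0_iff[of x y] not_adj_self by (cases "gdist w x y") auto

lemma gdist_adj_le_Suc: "adj w x y \<Longrightarrow> gdist w z y \<le> Suc (gdist w z x)"
  using gdist_triangle[of z y x] gdist_adj[of x y] by simp

lemma gsphere_predecessor:
  assumes "gdist w x0 y = Suc r"
  obtains x where "gdist w x0 x = r" "adj w x y"
proof -
  have "(adj w ^^ Suc r) x0 y"
    using gdist_path[of x0 y] assms by simp
  then obtain x where x: "(adj w ^^ r) x0 x" "adj w x y"
    by (auto elim: relpowp_Suc_E)
  have "gdist w x0 x = r"
    using gdist_le[OF x(1)] gdist_adj_le_Suc[OF x(2), of x0] assms by simp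
  then show thesis
    using x(2) that by blast
qed

lemma finite_gball: "finite {x. gdist w x0 x \<le> n}"
proof (induction n)
  case 0
  then show ?case by (simp add: gdist_eq_0_iff)
next
  case (Suc n)
  have "{x. gdist w x0 x \<le> Suc n}
      \<subseteq> {x. gdist w x0 x \<le> n} \<union> (\<Union>x\<in>{x. gdist w x0 x \<le> n}. {y. adj w x y})"
    by (auto simp: le_Suc_eq elim: gsphere_predecessor)
  then show ?case
    by (rule finite_subset) (use Suc locally_finite in auto)
qed

text \<open>The truncation is there because \<open>wasserstein\<close> admits only bounded test
  functions. The minus sign makes the function drop by 1 along an edge leading away from
  \<open>x0\<close>, as long as the cutoff is not reached.\<close>

lemma Lip1_truncated_gdist: "(\<lambda>z. - min (real (gdist w x0 z)) c) \<in> Lip1 w"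
proof -
  have "\<bar>min (real (gdist w x0 x)) c - min (real (gdist w x0 y)) c\<bar> \<le> real (gdist w x y)" for x y
    using gdist_triangle[of x0 x y] gdist_triangle[of x0 y x] gdist_sym[of x y] by linarith
  then show ?thesis
    by (simp add: Lip1_def abs_minus_commute)
qed

lemma Lip1_adj:
  assumes "f \<in> Lip1 w" "adj w x y"
  shows "\<bar>f y - f x\<bar> \<le> 1"
proof -
  have "\<bar>f x - f y\<bar> \<le> real (gdist w x y)"
    using assms(1) by (simp add: Lip1_def)
  then show ?thesis
    using gdist_adj[OF assms(2)] by simp
qed

end


section \<open>Curvature of edges\<close>

context weighted_graph
begin

text \<open>One step of the walk acts on functions as \<open>I + \<epsilon> \<Delta>\<close>,
  exactly and not just to first order. \<open>P\<close> may exceed the support so that the measures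
  at two vertices can be summed over a common set.\<close>

lemma sum_rw_measure:
  assumes "finite P" "insert x {z. adj w x z} \<subseteq> P"
  shows "(\<Sum>z\<in>P. f z * rw_measure w m \<epsilon> x z) = f x + \<epsilon> * laplacian w m f x"
proof -
  have "(\<Sum>z\<in>P. f z * rw_measure w m \<epsilon> x z)
      = (\<Sum>z\<in>insert x {z. adj w x z}. f z * rw_measure w m \<epsilon> x z)"
    using assms by (intro sum.mono_neutral_right) (auto simp: rw_measure_def w_eq_0_if_not_adj)
  also have "\<dots> = f x * (1 - \<epsilon> * Deg w m x) + (\<Sum>z | adj w x z. f z * rw_measure w m \<epsilon> x z)"
    using locally_finite by (subst sum.insert) (auto simp: not_adj_self rw_measure_def)
  also have "(\<Sum>z | adj w x z. f z * rw_measure w m \<epsilon> x z)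
      = \<epsilon> * ((\<Sum>z | adj w x z. w x z * f z) / m x)"
    unfolding sum_divide_distrib sum_distrib_left
    by (rule sum.cong) (auto simp: rw_measure_def not_adj_self)
  finally show ?thesis
    by (simp add: laplacian_split algebra_simps)
qed

lemma infsum_rw_measure_diff:
  "(\<Sum>\<^sub>\<infinity>z. f z * (rw_measure w m \<epsilon> x z - rw_measure w m \<epsilon> y z))
    = f x - f y + \<epsilon> * (laplacian w m f x - laplacian w m f y)"
proof -
  define P where "P = insert x {z. adj w x z} \<union> insert y {z. adj w y z}"
  have fin: "finite P"
    using locally_finite by (simp add: P_def)
  have "(\<Sum>\<^sub>\<infinity>z. f z * (rw_measure w m \<epsilon> x z - rw_measure w m \<epsilon> y z))
      = (\<Sum>\<^sub>\<infinity>z\<in>P. f z * (rw_measure w m \<epsilon> x z - rw_measure w m \<epsilon> y z))"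
    by (rule infsum_cong_neutral) (auto simp: P_def rw_measure_def w_eq_0_if_not_adj)
  also have "\<dots> = (\<Sum>z\<in>P. f z * rw_measure w m \<epsilon> x z) - (\<Sum>z\<in>P. f z * rw_measure w m \<epsilon> y z)"
    using fin by (simp add: right_diff_distrib sum_subtractf)
  also have "\<dots> = f x - f y + \<epsilon> * (laplacian w m f x - laplacian w m f y)"
    using fin by (subst (1 2) sum_rw_measure) (auto simp: P_def algebra_simps)
  finally show ?thesis .
qed

lemma bounded_truncated_gdist: "bounded (range (\<lambda>z. - min (real (gdist w x0 z)) c))"
  by (rule boundedI[of _ "\<bar>c\<bar>"]) (auto simp: min_def abs_if)

text \<open>Every test function bounds the supremum from below. The work lies in showing that the
  values are bounded above, as a real \<open>SUP\<close> requires: a Lipschitz function changes by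
  at most 1 along an edge, so its Laplacian is at most \<open>Deg\<close> in absolute value.\<close>

lemma curvature_eps_adj_le:
  assumes "adj w x y" "\<epsilon> > 0" "f \<in> Lip1 w" "bounded (range f)"
  shows "curvature_eps w m \<epsilon> x y
    \<le> 1 - (f x - f y) - \<epsilon> * (laplacian w m f x - laplacian w m f y)"
proof -
  have "f x - f y + \<epsilon> * (laplacian w m f x - laplacian w m f y)
      \<le> wasserstein w (rw_measure w m \<epsilon> x) (rw_measure w m \<epsilon> y)"
    unfolding wasserstein_def infsum_rw_measure_diff
  proof (rule cSUP_upper)
    show "bdd_above ((\<lambda>f. f x - f y + \<epsilon> * (laplacian w m f x - laplacian w m f y))
            ` {f \<in> Lip1 w. bounded (range f)})"
    proof (rule bdd_aboveI2)
      fix f assume "f \<in> {f \<in> Lip1 w. bounded (range f)}"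
      then have f: "\<bar>f v - f u\<bar> \<le> 1" if "adj w u v" for u v
        using that Lip1_adj by auto
      have "\<bar>laplacian w m f x\<bar> \<le> Deg w m x" "\<bar>laplacian w m f y\<bar> \<le> Deg w m y"
        using abs_laplacian_le[of x f 1] abs_laplacian_le[of y f 1] f by auto
      then have "laplacian w m f x - laplacian w m f y \<le> Deg w m x + Deg w m y"
        by linarith
      moreover have "f x - f y \<le> 1"
        using f[OF assms(1)] by linarith
      ultimately show "f x - f y + \<epsilon> * (laplacian w m f x - laplacian w m f y)
          \<le> 1 + \<epsilon> * (Deg w m x + Deg w m y)"
        using assms(2) by (intro add_mono mult_left_mono) auto
    qed
  qed (use assms in auto)
  then show ?thesis
    using gdist_adj[OF assms(1)] by (simp add: curvature_eps_def)
qed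

lemma curvature_eps_adj_ge:
  assumes "adj w x y"
    and "\<And>f. f \<in> Lip1 w \<Longrightarrow> bounded (range f) \<Longrightarrow>
      c \<le> 1 - (f x - f y) - \<epsilon> * (laplacian w m f x - laplacian w m f y)"
  shows "c \<le> curvature_eps w m \<epsilon> x y"
proof -
  have "wasserstein w (rw_measure w m \<epsilon> x) (rw_measure w m \<epsilon> y) \<le> 1 - c"
    unfolding wasserstein_def infsum_rw_measure_diff
  proof (rule cSUP_least)
    show "{f \<in> Lip1 w. bounded (range f)} \<noteq> {}"
      using Lip1_truncated_gdist bounded_truncated_gdist by blast
  qed (use assms(2) in \<open>fastforce simp: algebra_simps\<close>)
  then show ?thesis
    using gdist_adj[OF assms(1)] by (simp add: curvature_eps_def)
qed

text \<open>The limit exists because \<open>\<kappa>\<^sub>\<epsilon> / \<epsilon>\<close> is antitone in \<open>\<epsilon>\<close> and bounded above.\<close>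

lemma tendsto_curvature_adj:
  assumes "adj w x y"
  shows "((\<lambda>\<epsilon>. (1 / \<epsilon>) * curvature_eps w m \<epsilon> x y) \<longlongrightarrow> curvature w m x y) (at_right 0)"
proof -
  define h where "h \<epsilon> = (1 / \<epsilon>) * curvature_eps w m \<epsilon> x y" for \<epsilon>
  have antimono: "h b \<le> h a" if "0 < a" "a \<le> b" for a b
  proof -
    \<comment> \<open>For one test function the quotient is \<open>s / \<epsilon> - q\<close> with
      \<open>s \<ge> 0\<close>, hence antitone in \<epsilon>; this property survives the infimum
      over all test functions.\<close>
    have "a * h b \<le> curvature_eps w m a x y"
    proof (rule curvature_eps_adj_ge[OF assms])
      fix f assume f: "f \<in> Lip1 w" "bounded (range f)"
      define s where "s = 1 - (f x - f y)"
      define q where "q = laplacian w m f x - laplacian w m f y"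
      have s: "0 \<le> s"
        using Lip1_adj[OF f(1) assms] by (simp add: s_def)
      have "h b \<le> (s - b * q) / b"
        using curvature_eps_adj_le[OF assms _ f, of b] that
        by (simp add: h_def s_def q_def divide_right_mono)
      also have "\<dots> = s / b - q"
        using that by (simp add: field_simps)
      also have "\<dots> \<le> s / a - q"
        using that s by (simp add: divide_left_mono)
      finally have "a * h b \<le> a * (s / a - q)"
        using that by (intro mult_left_mono) auto
      then show "a * h b \<le> s - a * q"
        using that by (simp add: right_diff_distrib)
    qed
    then show ?thesis
      using that by (simp add: h_def field_simps)
  qed
  \<comment> \<open>A test function dropping by exactly 1 from \<open>x\<close> to \<open>y\<close>
    has \<open>s = 0\<close>, so its bound on \<open>h\<close> does not depend on
    \<epsilon>.\<close>
  define f0 where "f0 z = - min (real (gdist w x z)) 1" for z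
  have f0: "f0 \<in> Lip1 w" "bounded (range f0)" "f0 x - f0 y = 1"
    using Lip1_truncated_gdist[of x 1] bounded_truncated_gdist[of x 1] gdist_adj[OF assms]
    by (simp_all add: f0_def[abs_def])
  have bound: "h \<epsilon> \<le> laplacian w m f0 y - laplacian w m f0 x" if "\<epsilon> > 0" for \<epsilon>
  proof -
    have "curvature_eps w m \<epsilon> x y \<le> \<epsilon> * (laplacian w m f0 y - laplacian w m f0 x)"
      using curvature_eps_adj_le[OF assms that f0(1,2)] f0(3) by (simp add: algebra_simps)
    then show ?thesis
      using that by (simp add: h_def field_simps)
  qed
  define l where "l = (SUP \<epsilon>\<in>{0<..}. h \<epsilon>)"
  have bdd: "bdd_above (h ` {0<..})"
    by (rule bdd_aboveI2) (use bound in auto)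
  have "(h \<longlongrightarrow> l) (at_right 0)"
  proof (rule order_tendstoI)
    fix a assume "a < l"
    then obtain \<epsilon> where \<epsilon>: "\<epsilon> > 0" "a < h \<epsilon>"
      unfolding l_def using less_cSUP_iff[OF _ bdd, of a] by auto
    then have "a < h d" if "0 < d" "d < \<epsilon>" for d
      using antimono[of d \<epsilon>] that by linarith
    then show "\<forall>\<^sub>F d in at_right 0. a < h d"
      using \<epsilon>(1) by (auto simp: eventually_at_right_field)
  next
    fix a assume "l < a"
    have "h d \<le> l" if "0 < d" for d
      unfolding l_def using bdd that by (intro cSUP_upper) auto
    then have "h d < a" if "0 < d" for d
      using that \<open>l < a\<close> by (meson le_less_trans)
    then show "\<forall>\<^sub>F d in at_right 0. h d < a"
      by (auto simp: eventually_at_right_field intro: exI[of _ 1])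
  qed
  then have "(h \<longlongrightarrow> Lim (at_right 0) h) (at_right 0)"
    by (simp add: tendsto_Lim)
  then show ?thesis
    by (simp add: curvature_def h_def[abs_def])
qed

text \<open>A drop of exactly 1 cancels the leading 1, and dividing by \<epsilon> leaves a bound
  free of \<epsilon>.\<close>

lemma curvature_adj_le:
  assumes "adj w x y" "f \<in> Lip1 w" "bounded (range f)" "f x - f y = 1"
  shows "curvature w m x y \<le> laplacian w m f y - laplacian w m f x"
proof (rule tendsto_upperbound[OF tendsto_curvature_adj[OF assms(1)]])
  have "(1 / \<epsilon>) * curvature_eps w m \<epsilon> x y \<le> laplacian w m f y - laplacian w m f x"
    if "\<epsilon> > 0" for \<epsilon>
    using curvature_eps_adj_le[OF assms(1) that assms(2,3)] assms(4) that
    by (simp add: field_simps)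
  then show "\<forall>\<^sub>F \<epsilon> in at_right 0.
      (1 / \<epsilon>) * curvature_eps w m \<epsilon> x y \<le> laplacian w m f y - laplacian w m f x"
    by (auto simp: eventually_at_right_field intro: exI[of _ 1])
qed simp

text \<open>Test functions that drop by less than 1 leave a surplus which absorbs the term of order
  \<epsilon> once \<epsilon> is small; the threshold \<open>\<epsilon>0\<close> has to serve all
  test functions at once.\<close>

lemma curvature_adj_ge:
  assumes "adj w x y" "\<epsilon>0 > 0"
    and "\<And>\<epsilon> f. 0 < \<epsilon> \<Longrightarrow> \<epsilon> < \<epsilon>0 \<Longrightarrow> f \<in> Lip1 w \<Longrightarrow>
      \<epsilon> * c \<le> 1 - (f x - f y) - \<epsilon> * (laplacian w m f x - laplacian w m f y)"
  shows "c \<le> curvature w m x y"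
proof (rule tendsto_lowerbound[OF tendsto_curvature_adj[OF assms(1)]])
  have "c \<le> (1 / \<epsilon>) * curvature_eps w m \<epsilon> x y" if "0 < \<epsilon>" "\<epsilon> < \<epsilon>0" for \<epsilon>
    using curvature_eps_adj_ge[OF assms(1), of "\<epsilon> * c" \<epsilon>] assms(3)[of \<epsilon>] that
    by (simp add: field_simps)
  then show "\<forall>\<^sub>F \<epsilon> in at_right 0. c \<le> (1 / \<epsilon>) * curvature_eps w m \<epsilon> x y"
    using assms(2) by (auto simp: eventually_at_right_field)
qed simp

lemma curvature_le_laplacian_gdist:
  assumes "adj w x y" "gdist w x0 y = Suc (gdist w x0 x)"
  shows "curvature w m x y
    \<le> laplacian w m (\<lambda>z. real (gdist w x0 z)) x - laplacian w m (\<lambda>z. real (gdist w x0 z)) y"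
proof -
  \<comment> \<open>Neighbours of \<open>x\<close> and \<open>y\<close> are at distance at most
    \<open>gdist w x0 x + 2\<close> from \<open>x0\<close>, so this cutoff is invisible to both
    Laplacians.\<close>
  define f where "f z = - min (real (gdist w x0 z)) (gdist w x0 x + 2)" for z
  have "laplacian w m f u = laplacian w m (\<lambda>z. (-1) * real (gdist w x0 z)) u"
    if "u \<in> {x, y}" for u
  proof (rule laplacian_cong)
    fix z assume "adj w u z"
    then have "gdist w x0 z \<le> gdist w x0 x + 2" "gdist w x0 u \<le> gdist w x0 x + 2"
      using gdist_adj_le_Suc[of u z x0] that assms(2) by auto
    then show "f z - f u = (-1) * real (gdist w x0 z) - (-1) * real (gdist w x0 u)"
      by (simp add: f_def min_def)
  qed
  then have "laplacian w m f u = - laplacian w m (\<lambda>z. real (gdist w x0 z)) u"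
    if "u \<in> {x, y}" for u
    using that laplacian_cmult[of "-1"] by simp
  moreover have "curvature w m x y \<le> laplacian w m f y - laplacian w m f x"
    using Lip1_truncated_gdist[of x0] bounded_truncated_gdist[of x0] assms
    by (intro curvature_adj_le) (auto simp: f_def[abs_def])
  ultimately show ?thesis by simp
qed

end


section \<open>Stochastic completeness\<close>

context weighted_graph
begin

section \<open>From sphere curvatures to the Laplacian of the distance\<close>

lemma sphere_curvature_geD:
  assumes "sphere_curvature w m x0 (Suc r) \<ge> ereal c" "gdist w x0 y = Suc r"
  obtains x where "gdist w x0 x = r" "adj w x y" "c \<le> curvature w m x y"
proof -
  define P where "P y = {x \<in> gsphere w x0 r. adj w x y}" for y
  define M where "M y = Max ((\<lambda>x. curvature w m x y) ` P y)" for y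
  have fin: "finite (gsphere w x0 k)" for k
    by (rule finite_subset[OF _ finite_gball[of x0 k]]) (auto simp: gsphere_def)
  have y: "y \<in> gsphere w x0 (Suc r)"
    using assms(2) by (simp add: gsphere_def)
  have "c \<le> Min (M ` gsphere w x0 (Suc r))"
    using assms(1) y by (auto simp: sphere_curvature_def M_def[abs_def] P_def[abs_def] split: if_splits)
  also have "\<dots> \<le> M y"
    using fin y by (intro Min_le) auto
  finally have "c \<le> M y" .
  moreover have "P y \<noteq> {}"
    using gsphere_predecessor[OF assms(2)] by (fastforce simp: P_def gsphere_def)
  then have "M y \<in> (\<lambda>x. curvature w m x y) ` P y"
    unfolding M_def using fin by (intro Max_in) (auto simp: P_def)
  ultimately show thesis
    using that by (auto simp: P_def gsphere_def)
qed

text \<open>Induction on the radius: the max in the sphere curvature supplies one good inner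
  neighbour for each \<open>y\<close>, and passing from it to \<open>y\<close> costs at most
  \<open>C * ln r\<close>, where \<open>r\<close> is the radius of the sphere of
  \<open>y\<close>.\<close>

lemma laplacian_gdist_bound:
  assumes "C \<ge> 0"
    and "\<forall>\<^sub>F r in sequentially. sphere_curvature w m x0 r \<ge> ereal (- C * ln (real r))"
  obtains K where "K \<ge> 0"
    and "\<And>y. laplacian w m (\<lambda>z. real (gdist w x0 z)) y
          \<le> K * ((real (gdist w x0 y) + 3) * ln (real (gdist w x0 y) + 3))"
proof -
  define L where "L = laplacian w m (\<lambda>z. real (gdist w x0 z))"
  obtain N where N: "\<And>r. r \<ge> N \<Longrightarrow> sphere_curvature w m x0 r \<ge> ereal (- C * ln (real r))"
    using assms(2) by (auto simp: eventually_sequentially)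
  \<comment> \<open>\<open>M\<close> covers the finite ball on which the curvature hypothesis says
    nothing.\<close>
  define M where "M = Max (insert 0 (L ` {y. gdist w x0 y \<le> N}))"
  have M: "M \<ge> 0" "\<And>y. gdist w x0 y \<le> N \<Longrightarrow> L y \<le> M"
    using finite_gball[of x0 N] by (auto simp: M_def)
  have L: "L y \<le> M + C * (real r * ln (real r + 1))" if "gdist w x0 y = r" for r y
    using that
  proof (induction r arbitrary: y)
    case 0
    then show ?case using M(2)[of y] by simp
  next
    case (Suc r)
    show ?case
    proof (cases "Suc r \<le> N")
      case True
      then have "L y \<le> M"
        using M(2) Suc.prems by simp
      moreover have "0 \<le> C * (real (Suc r) * ln (real (Suc r) + 1))"
        using assms(1) by (intro mult_nonneg_nonneg) auto
      ultimately show ?thesis by linarith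
    next
      case False
      then obtain x where x: "gdist w x0 x = r" "adj w x y"
          "- C * ln (real (Suc r)) \<le> curvature w m x y"
        using sphere_curvature_geD[OF N Suc.prems] by (metis nat_le_linear)
      have "L y \<le> L x - curvature w m x y"
        using curvature_le_laplacian_gdist[OF x(2), of x0] x(1) Suc.prems by (simp add: L_def)
      also have "\<dots> \<le> (M + C * (real r * ln (real r + 1))) + C * ln (real r + 1)"
        using Suc.IH[OF x(1)] x(3) by (simp add: add.commute)
      also have "\<dots> = M + C * (real (Suc r) * ln (real r + 1))"
        by (simp add: algebra_simps)
      also have "\<dots> \<le> M + C * (real (Suc r) * ln (real (Suc r) + 1))"
        using assms(1) by (intro add_left_mono mult_left_mono) auto
      finally show ?thesis .
    qed
  qed
  show thesis
  proof
    show "M + C \<ge> 0"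
      using M(1) assms(1) by simp
    fix y
    define r where "r = real (gdist w x0 y)"
    have r: "r \<ge> 0"
      by (simp add: r_def)
    \<comment> \<open>The shift by 3 exceeds e, so the factor \<open>(r + 3) * ln (r + 3)\<close> is
      at least 1 and absorbs \<open>M\<close>. The same shift later makes the iterated logarithm
      non-negative.\<close>
    have "ln (exp 1) \<le> ln (r + 3)"
      using exp_le r by (intro ln_mono) auto
    then have ln1: "1 \<le> ln (r + 3)"
      by simp
    have "1 * 1 \<le> (r + 3) * ln (r + 3)"
      using r ln1 by (intro mult_mono) auto
    then have "M * 1 \<le> M * ((r + 3) * ln (r + 3))"
      using M(1) by (intro mult_left_mono) auto
    moreover have "C * (r * ln (r + 1)) \<le> C * ((r + 3) * ln (r + 3))"
      using r assms(1) by (intro mult_left_mono mult_mono ln_mono) auto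
    ultimately have "L y \<le> (M + C) * ((r + 3) * ln (r + 3))"
      using L[OF refl, of y] by (simp add: r_def algebra_simps)
    then show "laplacian w m (\<lambda>z. real (gdist w x0 z)) y
        \<le> (M + C) * ((real (gdist w x0 y) + 3) * ln (real (gdist w x0 y) + 3))"
      by (simp add: L_def r_def)
  qed
qed

text \<open>Concavity: bounding first the outer and then the inner logarithm by its tangent at
  \<open>x\<close> bounds the increments by those of the distance divided by \<open>a\<close>. The
  factor \<open>a\<close> is the growth allowed in the assumption.\<close>

lemma laplacian_ln_ln_gdist_le:
  assumes "laplacian w m (\<lambda>z. real (gdist w x0 z)) x
          \<le> K * ((real (gdist w x0 x) + 3) * ln (real (gdist w x0 x) + 3))"
  shows "laplacian w m (\<lambda>z. ln (ln (real (gdist w x0 z) + 3))) x \<le> K"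
proof -
  define \<rho> where "\<rho> z = real (gdist w x0 z)" for z
  define a where "a = (\<rho> x + 3) * ln (\<rho> x + 3)"
  have ln_pos: "ln (\<rho> z + 3) > 0" for z
    by (simp add: \<rho>_def)
  have \<rho>: "\<rho> z \<ge> 0" for z
    by (simp add: \<rho>_def)
  have a: "a > 0"
    using ln_pos \<rho>[of x] by (simp add: a_def)
  have "laplacian w m (\<lambda>z. ln (ln (\<rho> z + 3))) x \<le> laplacian w m (\<lambda>z. (1 / a) * \<rho> z) x"
  proof (rule laplacian_mono)
    fix y
    have "ln (ln (\<rho> y + 3)) - ln (ln (\<rho> x + 3)) \<le> (ln (\<rho> y + 3) - ln (\<rho> x + 3)) / ln (\<rho> x + 3)"
      using ln_pos by (intro ln_diff_le)
    also have "\<dots> \<le> (((\<rho> y + 3) - (\<rho> x + 3)) / (\<rho> x + 3)) / ln (\<rho> x + 3)"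
      using ln_pos[of x] \<rho>[of x] \<rho>[of y] by (intro divide_right_mono ln_diff_le) auto
    also have "\<dots> = (1 / a) * \<rho> y - (1 / a) * \<rho> x"
      by (simp add: a_def diff_divide_distrib)
    finally show "ln (ln (\<rho> y + 3)) - ln (ln (\<rho> x + 3)) \<le> (1 / a) * \<rho> y - (1 / a) * \<rho> x" .
  qed
  also have "\<dots> \<le> K"
    using assms a by (simp only: laplacian_cmult) (simp add: \<rho>_def[abs_def] a_def field_simps)
  finally show ?thesis
    by (simp add: \<rho>_def)
qed

text \<open>
  Khas'minskii's argument: at a negative minimum of \<open>v - 1 + \<delta> (\<psi> + (K + 1) t)\<close>, which lies
  over the finite set where \<open>\<psi> \<le> 1 / \<delta>\<close>, the time derivative would be positive.
\<close>

lemma heat_solution_one_ge_1: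
  assumes \<psi>: "\<And>x. \<psi> x \<ge> 0" "\<And>x. laplacian w m \<psi> x \<le> K" "\<And>c. finite {x. \<psi> x \<le> c}"
    and K: "K \<ge> 0"
    and v: "heat_solution w m (\<lambda>_. 1) v"
    and "t1 \<ge> 0"
  shows "v x1 t1 \<ge> 1"
proof (rule ccontr)
  assume "\<not> v x1 t1 \<ge> 1"
  then have less: "v x1 t1 < 1" by simp
  define q where "q = \<psi> x1 + (K + 1) * t1 + 1"
  \<comment> \<open>Chosen so that the penalty at \<open>(x1, t1)\<close> stays below half of the
    gap \<open>1 - v x1 t1\<close>, which keeps \<phi> negative there.\<close>
  define \<delta> where "\<delta> = (1 - v x1 t1) / (2 * q)"
  define \<phi> where "\<phi> x t = v x t - 1 + \<delta> * (\<psi> x + (K + 1) * t)" for x t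
  have pos: "q > 0"
    unfolding q_def using \<psi>(1)[of x1] K \<open>t1 \<ge> 0\<close> by (intro add_nonneg_pos add_nonneg_nonneg mult_nonneg_nonneg) auto
  then have \<delta>: "\<delta> > 0"
    using less by (simp add: \<delta>_def)
  have "\<delta> * (\<psi> x1 + (K + 1) * t1) \<le> \<delta> * q"
    using \<delta> by (simp add: q_def)
  also have "\<dots> = (1 - v x1 t1) / 2"
    using pos by (simp add: \<delta>_def)
  also have "\<dots> < 1 - v x1 t1"
    using less by simp
  finally have \<phi>_neg: "\<phi> x1 t1 < 0"
    by (simp add: \<phi>_def)
  have v_nonneg: "v x t \<ge> 0" if "t \<ge> 0" for x t
    using v that by (simp add: heat_solution_def)
  define B where "B = {x. \<psi> x \<le> 1 / \<delta>}"
  have finB: "finite B"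
    using \<psi>(3) by (simp add: B_def)
  have outside: "\<phi> x t \<ge> 0" if "x \<notin> B" "t \<ge> 0" for x t
  proof -
    have "1 \<le> \<delta> * \<psi> x"
      using that \<delta> by (simp add: B_def field_simps)
    moreover have "0 \<le> \<delta> * ((K + 1) * t)"
      using \<delta> K that by simp
    ultimately show ?thesis
      using v_nonneg[OF that(2), of x] by (simp add: \<phi>_def distrib_left)
  qed
  have "\<exists>s\<in>{0..t1}. \<forall>t\<in>{0..t1}. \<phi> x s \<le> \<phi> x t" for x
  proof (rule continuous_attains_inf)
    have "continuous_on {0..t1} (v x)"
      using v by (auto simp: heat_solution_def intro: continuous_on_subset)
    then show "continuous_on {0..t1} (\<phi> x)"
      unfolding \<phi>_def[abs_def] by (intro continuous_intros)
  qed (use \<open>t1 \<ge> 0\<close> in auto)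
  then obtain \<tau> where \<tau>: "\<And>x. \<tau> x \<in> {0..t1}" "\<And>x t. t \<in> {0..t1} \<Longrightarrow> \<phi> x (\<tau> x) \<le> \<phi> x t"
    by metis
  have x1B: "x1 \<in> B"
    using outside[of x1 t1] \<phi>_neg \<open>t1 \<ge> 0\<close> by force
  \<comment> \<open>Minimising first in time and then over the finite set \<open>B\<close> gives a
    minimum over all vertices and times in \<open>{0..t1}\<close>, since \<phi> is non-negative
    outside \<open>B\<close>.\<close>
  define x where "x = arg_min_on (\<lambda>x. \<phi> x (\<tau> x)) B"
  define s where "s = \<tau> x"
  have xB: "\<And>y. y \<in> B \<Longrightarrow> \<phi> x s \<le> \<phi> y (\<tau> y)"
    unfolding s_def x_def using finB x1B arg_min_least[of B] by (metis empty_iff)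
  have s: "0 \<le> s" "s \<le> t1"
    using \<tau>(1)[of x] by (auto simp: s_def)
  have neg: "\<phi> x s < 0"
    using xB[OF x1B] \<tau>(2)[of t1 x1] \<phi>_neg \<open>t1 \<ge> 0\<close> by simp
  have min: "\<phi> x s \<le> \<phi> y t" if "t \<in> {0..t1}" for y t
    using xB[of y] \<tau>(2)[OF that, of y] outside[of y t] neg that by (cases "y \<in> B") auto
  have "\<phi> x 0 \<ge> 0"
    using v \<psi>(1) \<delta> by (simp add: \<phi>_def heat_solution_def)
  then have "s \<noteq> 0"
    using neg by auto
  then have "s > 0"
    using s by simp
  have "laplacian w m (\<lambda>y. 0) x \<le> laplacian w m (\<lambda>y. \<phi> y s) x"
    using min s by (intro laplacian_mono) auto
  then have "0 \<le> laplacian w m (\<lambda>y. \<phi> y s) x"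
    by (simp add: laplacian_const)
  also have "\<dots> = laplacian w m (\<lambda>y. v y s + \<delta> * \<psi> y) x"
    by (rule laplacian_cong) (simp add: \<phi>_def algebra_simps)
  also have "\<dots> = laplacian w m (\<lambda>y. v y s) x + \<delta> * laplacian w m \<psi> x"
    by (simp only: laplacian_add laplacian_cmult)
  also have "\<dots> \<le> laplacian w m (\<lambda>y. v y s) x + \<delta> * K"
    using \<psi>(2) \<delta> by simp
  \<comment> \<open>The slope \<open>K + 1\<close> instead of \<open>K\<close> in the penalty makes
    this inequality strict.\<close>
  finally have deriv_pos: "0 < laplacian w m (\<lambda>y. v y s) x + \<delta> * (K + 1)"
    using \<delta> by (simp add: distrib_left)
  have "(v x has_real_derivative laplacian w m (\<lambda>y. v y s) x) (at s within {0..})"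
    using v s by (simp add: heat_solution_def)
  then have "(\<phi> x has_real_derivative laplacian w m (\<lambda>y. v y s) x + \<delta> * (K + 1)) (at s within {0..})"
    unfolding \<phi>_def[abs_def] by (auto intro!: derivative_eq_intros)
  \<comment> \<open>Only times before \<open>s\<close> are compared, so the case
    \<open>s = t1\<close> is covered; \<open>s > 0\<close> leaves room to the left.\<close>
  then obtain d where d: "d > 0"
      "\<And>h. h > 0 \<Longrightarrow> s - h \<in> {0..} \<Longrightarrow> h < d \<Longrightarrow> \<phi> x (s - h) < \<phi> x s"
    using has_real_derivative_pos_inc_left[OF _ deriv_pos] by blast
  define h where "h = min (d / 2) s"
  have "\<phi> x (s - h) < \<phi> x s"
    using d(1) \<open>s > 0\<close> by (intro d(2)) (auto simp: h_def)
  moreover have "\<phi> x s \<le> \<phi> x (s - h)"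
    using s d(1) \<open>s > 0\<close> by (intro min) (auto simp: h_def)
  ultimately show False by simp
qed

section \<open>Minimal heat solutions and the semigroup\<close>

lemma heat_semigroup_eqI:
  assumes "minimal_heat_solution w m f u" "t \<ge> 0"
  shows "heat_semigroup w m t f x = u x t"
  unfolding heat_semigroup_def
proof (rule the_equality)
  fix p assume "\<exists>v. minimal_heat_solution w m f v \<and> p = v x t"
  then show "p = u x t"
    using assms unfolding minimal_heat_solution_def by (metis order_antisym)
qed (use assms(1) in blast)

text \<open>The constant 1 is itself a solution, so it is the minimal one as soon as every other
  solution lies above it.\<close>

lemma stochastically_completeI:
  assumes "\<And>v x t. heat_solution w m (\<lambda>_. 1) v \<Longrightarrow> t \<ge> 0 \<Longrightarrow> v x t \<ge> 1"
  shows "stochastically_complete w m"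
proof -
  have "minimal_heat_solution w m (\<lambda>_. 1) (\<lambda>_ _. 1)"
    using assms by (auto simp: minimal_heat_solution_def heat_solution_def laplacian_const)
  then show ?thesis
    by (auto simp: stochastically_complete_def heat_semigroup_eqI)
qed

theorem stochastically_complete_if_sphere_curvature_ge:
  assumes "C > 0"
    and "\<forall>\<^sub>F r in sequentially. sphere_curvature w m x0 r \<ge> ereal (- C * ln (real r))"
  shows "stochastically_complete w m"
proof -
  obtain K where K: "K \<ge> 0" "\<And>y. laplacian w m (\<lambda>z. real (gdist w x0 z)) y
          \<le> K * ((real (gdist w x0 y) + 3) * ln (real (gdist w x0 y) + 3))"
    using laplacian_gdist_bound[of C x0] assms by auto
  define \<psi> where "\<psi> z = ln (ln (real (gdist w x0 z) + 3))" for z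
  have ln1: "1 \<le> ln (real k + 3)" for k
  proof -
    have "ln (exp 1) \<le> ln (real k + 3)"
      using exp_le by (intro ln_mono) auto
    then show ?thesis by simp
  qed
  have \<psi>_nonneg: "\<psi> x \<ge> 0" for x
    using ln1 by (simp add: \<psi>_def)
  have fin: "finite {x. \<psi> x \<le> c}" for c
  proof (rule finite_subset)
    show "{x. \<psi> x \<le> c} \<subseteq> {x. gdist w x0 x \<le> nat \<lceil>exp (exp c)\<rceil>}"
    proof safe
      fix x assume "\<psi> x \<le> c"
      then have "exp (\<psi> x) \<le> exp c"
        by simp
      then have "ln (real (gdist w x0 x) + 3) \<le> exp c"
        using ln1[of "gdist w x0 x"] by (simp add: \<psi>_def)
      moreover have "real (gdist w x0 x) + 3 = exp (ln (real (gdist w x0 x) + 3))"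
        by simp
      ultimately have "real (gdist w x0 x) + 3 \<le> exp (exp c)"
        by (metis exp_le_cancel_iff)
      then show "gdist w x0 x \<le> nat \<lceil>exp (exp c)\<rceil>"
        by linarith
    qed
  qed (rule finite_gball)
  show ?thesis
  proof (rule stochastically_completeI)
    fix v x and t :: real
    assume "heat_solution w m (\<lambda>_. 1) v" "t \<ge> 0"
    then show "v x t \<ge> 1"
      using laplacian_ln_ln_gdist_le[OF K(2)] K(1) \<psi>_nonneg fin
      by (intro heat_solution_one_ge_1[of \<psi> K]) (auto simp: \<psi>_def[abs_def])
  qed
qed

end


section \<open>The minimal solution of the heat equation\<close>

text \<open>Integrating factor: \<open>exp (D * s) * g s\<close> has derivative
  \<open>exp (D * s) * h s\<close> and therefore cannot decrease. All comparisons between iterates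
  and solutions reduce to this scalar fact.\<close>

lemma nonneg_if_deriv_ge_decay:
  fixes g h :: "real \<Rightarrow> real"
  assumes deriv: "\<And>s. 0 \<le> s \<Longrightarrow> s \<le> t \<Longrightarrow> (g has_real_derivative h s - D * g s) (at s within {0..})"
    and h: "\<And>s. 0 \<le> s \<Longrightarrow> s \<le> t \<Longrightarrow> h s \<ge> 0"
    and "g 0 \<ge> 0" "t \<ge> 0"
  shows "g t \<ge> 0"
proof -
  have deriv': "((\<lambda>s. exp (D * s) * g s) has_real_derivative exp (D * s) * h s) (at s within {0..})"
    if "0 \<le> s" "s \<le> t" for s
    using deriv[OF that] by (auto intro!: derivative_eq_intros simp: algebra_simps)
  have "exp (D * 0) * g 0 \<le> exp (D * t) * g t"
  proof (rule DERIV_nonneg_imp_increasing_open[OF \<open>t \<ge> 0\<close>])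
    fix s assume s: "0 < s" "s < t"
    have "at s within {0..} = at s"
      using s by (intro at_within_interior) (simp add: interior_real_atLeast)
    then show "\<exists>y. ((\<lambda>s. exp (D * s) * g s) has_real_derivative y) (at s) \<and> y \<ge> 0"
      using deriv'[of s] h[of s] s by (intro exI[of _ "exp (D * s) * h s"]) simp
  next
    show "continuous_on {0..t} (\<lambda>s. exp (D * s) * g s)"
      by (rule DERIV_continuous_on[of _ _ "\<lambda>s. exp (D * s) * h s"])
        (use deriv' in \<open>auto intro: has_field_derivative_subset[of _ _ _ "{0..}"]\<close>)
  qed
  then show ?thesis
    using \<open>g 0 \<ge> 0\<close> by (smt (verit) exp_gt_zero mult_nonneg_nonneg mult_pos_neg)
qed

text \<open>Integration results are stated on compact intervals; the extra 1 keeps \<open>t\<close>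
  away from the right end, and the left end 0 is shared.\<close>

lemma at_within_atLeastAtMost_plus_1:
  fixes t :: real
  assumes "t \<ge> 0"
  shows "at t within {0..t + 1} = at t within {0..}"
  by (rule at_within_nhd[of _ "{..<t + 1}"]) auto

context weighted_graph
begin

text \<open>The gain term of the Laplacian. Despite the name, its weights sum to
  \<open>Deg w m x\<close> and not to 1.\<close>

abbreviation nbr_mean :: "('v \<Rightarrow> real \<Rightarrow> real) \<Rightarrow> 'v \<Rightarrow> real \<Rightarrow> real" where
  "nbr_mean u x t \<equiv> (\<Sum>y | adj w x y. w x y * u y t) / m x"

text \<open>Variation of constants for \<open>g' = nbr_mean u x - Deg w m x * g\<close> with
  \<open>g 0 = f x\<close>: freezing the neighbours decouples the system into scalar
  equations.\<close>

definition duhamel :: "('v \<Rightarrow> real) \<Rightarrow> ('v \<Rightarrow> real \<Rightarrow> real) \<Rightarrow> 'v \<Rightarrow> real \<Rightarrow> real" where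
  "duhamel f u x t =
    exp (- Deg w m x * t) * (f x + integral {0..t} (\<lambda>s. exp (Deg w m x * s) * nbr_mean u x s))"

text \<open>Probabilistically, iterate \<open>n\<close> keeps only the paths of the jump process
  with fewer than \<open>n\<close> jumps by time \<open>t\<close>.\<close>

primrec feller :: "('v \<Rightarrow> real) \<Rightarrow> nat \<Rightarrow> 'v \<Rightarrow> real \<Rightarrow> real" where
  "feller f 0 = (\<lambda>_ _. 0)"
| "feller f (Suc n) = duhamel f (feller f n)"

definition feller_limit :: "('v \<Rightarrow> real) \<Rightarrow> 'v \<Rightarrow> real \<Rightarrow> real" where
  "feller_limit f x t = lim (\<lambda>n. feller f n x t)"

section \<open>Monotonicity and comparison for Feller's iteration\<close>

lemma nbr_mean_mono:
  assumes "\<And>y. u y t \<le> v y t"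
  shows "nbr_mean u x t \<le> nbr_mean v x t"
  using assms m_pos[of x] by (intro divide_right_mono sum_mono mult_left_mono w_nonneg) auto

lemma nbr_mean_nonneg: "(\<And>y. u y t \<ge> 0) \<Longrightarrow> nbr_mean u x t \<ge> 0"
  using nbr_mean_mono[of "\<lambda>_ _. 0" t u x] by simp

lemma continuous_on_nbr_mean:
  assumes "\<And>y. continuous_on S (u y)"
  shows "continuous_on S (nbr_mean u x)"
  using m_pos[of x] by (intro continuous_intros assms) auto

lemma duhamel_0: "duhamel f u x 0 = f x"
  by (simp add: duhamel_def)

lemma duhamel_deriv:
  assumes cont: "\<And>y. continuous_on {0..} (u y)" and "t \<ge> 0"
  shows "(duhamel f u x has_real_derivative nbr_mean u x t - Deg w m x * duhamel f u x t)
    (at t within {0..})"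
proof -
  define D where "D = Deg w m x"
  define g where "g s = exp (D * s) * nbr_mean u x s" for s
  have "continuous_on {0..} g"
    unfolding g_def[abs_def] by (intro continuous_on_mult continuous_on_nbr_mean cont continuous_intros)
  then have "continuous_on {0..t + 1} g"
    by (rule continuous_on_subset) auto
  then have "((\<lambda>r. integral {0..r} g) has_real_derivative g t) (at t within {0..t + 1})"
    by (rule integral_has_real_derivative) (use \<open>t \<ge> 0\<close> in auto)
  then have "((\<lambda>r. integral {0..r} g) has_real_derivative g t) (at t within {0..})"
    using at_within_atLeastAtMost_plus_1[OF \<open>t \<ge> 0\<close>] by simp
  then have "((\<lambda>r. exp (- D * r) * (f x + integral {0..r} g)) has_real_derivative
      exp (- D * t) * g t - D * (exp (- D * t) * (f x + integral {0..t} g))) (at t within {0..})"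
    by (auto intro!: derivative_eq_intros simp: algebra_simps)
  moreover have "exp (- D * t) * g t = nbr_mean u x t"
    by (simp add: g_def exp_minus field_simps)
  moreover have "duhamel f u x = (\<lambda>r. exp (- D * r) * (f x + integral {0..r} g))"
    by (simp add: fun_eq_iff duhamel_def g_def[abs_def] D_def)
  ultimately show ?thesis
    by (simp only: D_def)
qed

lemma continuous_on_feller: "continuous_on {0..} (feller f n x)"
proof (induction n arbitrary: x)
  case (Suc n)
  show ?case
    using duhamel_deriv[of "feller f n" _ f x] Suc
    by (intro DERIV_continuous_on[of _ _ "\<lambda>t. nbr_mean (feller f n) x t - Deg w m x * duhamel f (feller f n) x t"])
      auto
qed simp

lemma feller_deriv:
  "t \<ge> 0 \<Longrightarrow> (feller f (Suc n) x has_real_derivative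
    nbr_mean (feller f n) x t - Deg w m x * feller f (Suc n) x t) (at t within {0..})"
  using duhamel_deriv[of "feller f n" t f x] continuous_on_feller by simp

text \<open>Induction on \<open>n\<close>: the difference satisfies the scalar decay equation, with
  a source that is non-negative because the previous iterate already lies below \<open>v\<close>.
  The horizon \<open>T\<close> admits comparison functions that stay non-negative only for a finite
  time, as on the chain.\<close>

lemma feller_le:
  assumes v0: "\<And>y. v y 0 \<ge> f y"
    and v_nonneg: "\<And>y s. 0 \<le> s \<Longrightarrow> s \<le> T \<Longrightarrow> v y s \<ge> 0"
    and v_deriv: "\<And>y s. 0 \<le> s \<Longrightarrow> s \<le> T \<Longrightarrow>
      (v y has_real_derivative laplacian w m (\<lambda>z. v z s) y) (at s within {0..})"
    and "0 \<le> t" "t \<le> T"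
  shows "feller f n x t \<le> v x t"
  using \<open>0 \<le> t\<close> \<open>t \<le> T\<close>
proof (induction n arbitrary: x t)
  case 0
  then show ?case using v_nonneg by simp
next
  case (Suc n)
  have "v x t - feller f (Suc n) x t \<ge> 0"
  proof (rule nonneg_if_deriv_ge_decay[where g = "\<lambda>s. v x s - feller f (Suc n) x s"
        and h = "\<lambda>s. nbr_mean v x s - nbr_mean (feller f n) x s" and D = "Deg w m x"])
    fix s assume s: "0 \<le> s" "s \<le> t"
    then have "(v x has_real_derivative nbr_mean v x s - Deg w m x * v x s) (at s within {0..})"
      using v_deriv[of s x] Suc.prems by (simp add: laplacian_split)
    from DERIV_diff[OF this feller_deriv[OF s(1), of f n x]]
    show "((\<lambda>s. v x s - feller f (Suc n) x s) has_real_derivative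
        nbr_mean v x s - nbr_mean (feller f n) x s - Deg w m x * (v x s - feller f (Suc n) x s))
        (at s within {0..})"
      by (simp add: algebra_simps)
    show "nbr_mean v x s - nbr_mean (feller f n) x s \<ge> 0"
      using Suc.IH Suc.prems s nbr_mean_mono[of "feller f n" s v x] by simp
  qed (use v0 Suc.prems in \<open>simp_all add: duhamel_0\<close>)
  then show ?case by simp
qed

lemma feller_mono_Suc:
  assumes f: "\<And>y. f y \<ge> 0" and "t \<ge> 0"
  shows "feller f n x t \<le> feller f (Suc n) x t"
  using \<open>t \<ge> 0\<close>
proof (induction n arbitrary: x t)
  case 0
  have "feller f 1 x t \<ge> 0"
  proof (rule nonneg_if_deriv_ge_decay[where g = "feller f 1 x" and h = "\<lambda>_. 0" and D = "Deg w m x"])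
    fix s :: real assume "0 \<le> s"
    then show "(feller f 1 x has_real_derivative 0 - Deg w m x * feller f 1 x s) (at s within {0..})"
      using feller_deriv[of s f 0 x] by simp
  qed (use f 0 in \<open>simp_all add: duhamel_0\<close>)
  then show ?case by simp
next
  case (Suc n)
  have "feller f (Suc (Suc n)) x t - feller f (Suc n) x t \<ge> 0"
  proof (rule nonneg_if_deriv_ge_decay[where g = "\<lambda>s. feller f (Suc (Suc n)) x s - feller f (Suc n) x s"
        and h = "\<lambda>s. nbr_mean (feller f (Suc n)) x s - nbr_mean (feller f n) x s" and D = "Deg w m x"])
    fix s assume s: "0 \<le> s" "s \<le> t"
    from DERIV_diff[OF feller_deriv[OF s(1), of f "Suc n" x] feller_deriv[OF s(1), of f n x]]
    show "((\<lambda>s. feller f (Suc (Suc n)) x s - feller f (Suc n) x s) has_real_derivative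
        nbr_mean (feller f (Suc n)) x s - nbr_mean (feller f n) x s
          - Deg w m x * (feller f (Suc (Suc n)) x s - feller f (Suc n) x s)) (at s within {0..})"
      by (simp add: algebra_simps)
    show "nbr_mean (feller f (Suc n)) x s - nbr_mean (feller f n) x s \<ge> 0"
      using Suc.IH s nbr_mean_mono[of "feller f n" s "feller f (Suc n)" x] by (simp del: feller.simps)
  qed (use Suc.prems in \<open>simp_all add: duhamel_0\<close>)
  then show ?case by simp
qed

lemma feller_nonneg:
  assumes "\<And>y. f y \<ge> 0" "t \<ge> 0"
  shows "feller f n x t \<ge> 0"
proof (induction n)
  case (Suc n)
  then show ?case
    using feller_mono_Suc[of f t n x] assms by (meson order_trans)
qed simp

lemma feller_le_const:
  assumes "\<And>y. 0 \<le> f y" "\<And>y. f y \<le> B" "t \<ge> 0"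
  shows "feller f n x t \<le> B"
proof -
  have "0 \<le> B"
    using assms(1,2)[of x] by linarith
  then show ?thesis
    using assms by (intro feller_le[where v = "\<lambda>_ _. B" and T = t]) (auto simp: laplacian_const)
qed

section \<open>The limit of the iteration as minimal solution\<close>

lemma feller_tendsto:
  assumes f: "\<And>y. 0 \<le> f y" "\<And>y. f y \<le> B" and t: "t \<ge> 0"
  shows "(\<lambda>n. feller f n x t) \<longlonglongrightarrow> feller_limit f x t"
proof -
  have "incseq (\<lambda>n. feller f n x t)"
    using feller_mono_Suc[of f t, OF f(1) t] by (intro incseq_SucI)
  then have "convergent (\<lambda>n. feller f n x t)"
    using feller_le_const[of f B t, OF f t] by (metis convergentI incseq_convergent[of _ B])
  then show ?thesis
    by (simp add: feller_limit_def convergent_LIMSEQ_iff)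
qed

lemma feller_limit_bounds:
  assumes f: "\<And>y. 0 \<le> f y" "\<And>y. f y \<le> B" and t: "t \<ge> 0"
  shows "0 \<le> feller_limit f x t" "feller_limit f x t \<le> B"
proof -
  note lim = feller_tendsto[of f B t x, OF f t]
  show "0 \<le> feller_limit f x t"
    by (rule LIMSEQ_le_const[OF lim]) (use feller_nonneg[of f t, OF f(1) t] in blast)
  show "feller_limit f x t \<le> B"
    by (rule LIMSEQ_le_const2[OF lim]) (use feller_le_const[of f B t, OF f t] in blast)
qed

text \<open>Dominated convergence in Duhamel's formula. Since the iterates lie between 0 and
  \<open>B\<close> and each vertex has finitely many neighbours, a constant dominates the integrands
  on \<open>{0..t}\<close>.\<close>

lemma feller_limit_eq_duhamel:
  assumes f: "\<And>y. 0 \<le> f y" "\<And>y. f y \<le> B" and t: "t \<ge> 0"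
  shows "(\<lambda>s. exp (Deg w m x * s) * nbr_mean (feller_limit f) x s) integrable_on {0..t}"
    and "feller_limit f x t = duhamel f (feller_limit f) x t"
proof -
  define D where "D = Deg w m x"
  define g where "g n s = exp (D * s) * nbr_mean (feller f n) x s" for n s
  define h where "h s = exp (D * s) * nbr_mean (feller_limit f) x s" for s
  have g_cont: "continuous_on {0..t} (g n)" for n
    unfolding g_def[abs_def]
    by (intro continuous_on_mult continuous_on_nbr_mean continuous_intros
        continuous_on_subset[OF continuous_on_feller]) auto
  have g_bound: "norm (g n s) \<le> exp (D * t) * nbr_mean (\<lambda>_ _. B) x 0" if "s \<in> {0..t}" for n s
  proof -
    have "nbr_mean (feller f n) x s \<le> nbr_mean (\<lambda>_ _. B) x s" "0 \<le> nbr_mean (feller f n) x s"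
      using that feller_nonneg[of f, OF f(1)] feller_le_const[of f B, OF f]
      by (intro nbr_mean_mono nbr_mean_nonneg; simp)+
    moreover have "exp (D * s) \<le> exp (D * t)"
      using that Deg_nonneg[of x] by (auto simp: D_def intro: mult_left_mono)
    ultimately have "exp (D * s) * nbr_mean (feller f n) x s \<le> exp (D * t) * nbr_mean (\<lambda>_ _. B) x s"
      by (intro mult_mono) auto
    moreover have "0 \<le> exp (D * s) * nbr_mean (feller f n) x s"
      using \<open>0 \<le> nbr_mean (feller f n) x s\<close> by (intro mult_nonneg_nonneg) auto
    ultimately show ?thesis
      unfolding g_def real_norm_def by (metis abs_of_nonneg)
  qed
  have g_tendsto: "(\<lambda>n. g n s) \<longlonglongrightarrow> h s" if "s \<in> {0..t}" for s
    unfolding g_def h_def using that m_pos[of x]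
    by (intro tendsto_intros feller_tendsto[OF f]) auto
  note conv = dominated_convergence[of g "{0..t}" "\<lambda>_. exp (D * t) * nbr_mean (\<lambda>_ _. B) x 0" h,
      OF integrable_continuous_real[OF g_cont] integrable_const_ivl g_bound g_tendsto]
  show "(\<lambda>s. exp (Deg w m x * s) * nbr_mean (feller_limit f) x s) integrable_on {0..t}"
    using conv(1) by (simp add: h_def[abs_def] D_def)
  have "(\<lambda>n. exp (- D * t) * (f x + integral {0..t} (g n)))
      \<longlonglongrightarrow> exp (- D * t) * (f x + integral {0..t} h)"
    by (intro tendsto_intros conv(2))
  then have "(\<lambda>n. feller f (Suc n) x t) \<longlonglongrightarrow> duhamel f (feller_limit f) x t"
    by (simp add: duhamel_def g_def[abs_def] h_def[abs_def] D_def)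
  moreover have "(\<lambda>n. feller f (Suc n) x t) \<longlonglongrightarrow> feller_limit f x t"
    by (rule LIMSEQ_Suc[OF feller_tendsto[OF assms]])
  ultimately show "feller_limit f x t = duhamel f (feller_limit f) x t"
    using LIMSEQ_unique by blast
qed

text \<open>Bootstrapping: integrability of the integrand already makes Duhamel's formula continuous
  in time. Continuity at all vertices then permits differentiating that formula.\<close>

lemma continuous_on_feller_limit:
  assumes f: "\<And>y. 0 \<le> f y" "\<And>y. f y \<le> B"
  shows "continuous_on {0..} (feller_limit f x)"
  unfolding continuous_on_eq_continuous_within
proof
  fix t :: real assume "t \<in> {0..}"
  then have t: "t \<ge> 0" by simp
  have "continuous_on {0..t + 1} (duhamel f (feller_limit f) x)"
    unfolding duhamel_def[abs_def] using t
    by (intro continuous_intros indefinite_integral_continuous_1 feller_limit_eq_duhamel(1)[OF f]) auto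
  then have "continuous_on {0..t + 1} (feller_limit f x)"
    by (rule continuous_on_eq) (use feller_limit_eq_duhamel(2)[of f B, OF f] in auto)
  then have "continuous (at t within {0..t + 1}) (feller_limit f x)"
    using t by (simp add: continuous_on_eq_continuous_within)
  then show "continuous (at t within {0..}) (feller_limit f x)"
    using at_within_atLeastAtMost_plus_1[OF t] by simp
qed

lemma feller_limit_le:
  assumes f: "\<And>y. 0 \<le> f y" "\<And>y. f y \<le> B"
    and v0: "\<And>y. v y 0 \<ge> f y"
    and v_nonneg: "\<And>y s. 0 \<le> s \<Longrightarrow> s \<le> T \<Longrightarrow> v y s \<ge> 0"
    and v_deriv: "\<And>y s. 0 \<le> s \<Longrightarrow> s \<le> T \<Longrightarrow>
      (v y has_real_derivative laplacian w m (\<lambda>z. v z s) y) (at s within {0..})"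
    and t: "0 \<le> t" "t \<le> T"
  shows "feller_limit f x t \<le> v x t"
  using feller_le[of f v T t, OF v0 v_nonneg v_deriv t]
  by (intro LIMSEQ_le_const2[OF feller_tendsto[OF f t(1)]]) auto

theorem minimal_heat_solution_feller_limit:
  assumes f: "\<And>y. 0 \<le> f y" "\<And>y. f y \<le> B"
  shows "minimal_heat_solution w m f (feller_limit f)"
  unfolding minimal_heat_solution_def
proof (intro conjI allI impI)
  have "(feller_limit f x has_real_derivative laplacian w m (\<lambda>y. feller_limit f y t) x) (at t within {0..})"
    if t: "t \<ge> 0" for x t
  proof -
    have "(duhamel f (feller_limit f) x has_real_derivative laplacian w m (\<lambda>y. feller_limit f y t) x)
        (at t within {0..})"
      using duhamel_deriv[of "feller_limit f" t f x] continuous_on_feller_limit[of f B, OF f] t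
        feller_limit_eq_duhamel(2)[of f B t x, OF f t] by (simp add: laplacian_split)
    then show ?thesis
      by (rule has_field_derivative_transform_within[OF _ zero_less_one])
        (use t feller_limit_eq_duhamel(2)[of f B, OF f] in auto)
  qed
  then show "heat_solution w m f (feller_limit f)"
    using feller_limit_bounds[of f B, OF f] continuous_on_feller_limit[of f B, OF f]
      feller_limit_eq_duhamel(2)[of f B 0, OF f] duhamel_0
    unfolding heat_solution_def by (intro conjI allI impI exI[of _ B]) auto
next
  fix v x and t :: real
  assume "heat_solution w m f v" "t \<ge> 0"
  then show "feller_limit f x t \<le> v x t"
    by (intro feller_limit_le[where T = t and B = B] f) (auto simp: heat_solution_def)
qed

end


section \<open>Birth-death chains of critical growth\<close>

interpretation chain: weighted_graph "chain_weight \<epsilon>" "\<lambda>_. 1" for \<epsilon>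
  using birth_death_chain_chain_weight by (rule birth_death_chain.axioms(1))

lemma adj_chain_weight: "adj (chain_weight \<epsilon>) j k \<longleftrightarrow> k = Suc j \<or> j = Suc k"
  using chain_rate_pos by (auto simp: adj_def chain_weight_def)

lemma laplacian_chain_0:
  "laplacian (chain_weight \<epsilon>) (\<lambda>_. 1) f 0 = chain_rate \<epsilon> 0 * (f 1 - f 0)"
proof -
  have "{k. adj (chain_weight \<epsilon>) 0 k} = {1}"
    by (auto simp: adj_chain_weight)
  then show ?thesis
    by (simp add: chain.laplacian_eq chain_weight_def)
qed

lemma laplacian_chain_Suc:
  "laplacian (chain_weight \<epsilon>) (\<lambda>_. 1) f (Suc n)
    = chain_rate \<epsilon> (Suc n) * (f (Suc (Suc n)) - f (Suc n)) - chain_rate \<epsilon> n * (f (Suc n) - f n)"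
proof -
  have "{k. adj (chain_weight \<epsilon>) (Suc n) k} = {n, Suc (Suc n)}"
    by (auto simp: adj_chain_weight)
  then show ?thesis
    by (simp add: chain.laplacian_eq chain_weight_def algebra_simps)
qed

lemma chain_rate_Suc:
  "chain_rate \<epsilon> (Suc R) = chain_rate \<epsilon> R + (\<Sum>k=1..Suc R. ln (real k) powr (1 + \<epsilon>))"
  by (simp add: chain_rate_def)

lemma gdist_chain: "gdist (chain_weight \<epsilon>) 0 n = n"
proof (rule antisym)
  have "(adj (chain_weight \<epsilon>) ^^ n) 0 n"
    by (induction n) (auto simp: adj_chain_weight)
  then show "gdist (chain_weight \<epsilon>) 0 n \<le> n"
    by (rule chain.gdist_le)
  have "k \<le> l" if "(adj (chain_weight \<epsilon>) ^^ l) 0 k" for k l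
    using that by (induction l arbitrary: k) (fastforce simp: adj_chain_weight)+
  then show "n \<le> gdist (chain_weight \<epsilon>) 0 n"
    using chain.gdist_path by blast
qed

text \<open>The bound is minus the second difference of the rates. Lipschitz test functions gain at
  most the rate on each of the two outer edges, and falling short of a unit drop on the middle edge
  does not pay off for small \<open>\<eta>\<close>.\<close>

lemma curvature_chain_ge:
  "- (ln (real (Suc (Suc q))) powr (1 + \<epsilon>))
    \<le> curvature (chain_weight \<epsilon>) (\<lambda>_. 1) (Suc q) (Suc (Suc q))"
proof (rule chain.curvature_adj_ge)
  define a where "a = chain_rate \<epsilon>"
  have a: "a n > 0" for n
    by (simp add: a_def chain_rate_pos)
  show "adj (chain_weight \<epsilon>) (Suc q) (Suc (Suc q))"
    by (simp add: adj_chain_weight)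
  show "1 / (2 * chain_rate \<epsilon> (Suc q)) > 0"
    by (simp add: chain_rate_pos)
  fix \<eta> f
  assume \<eta>: "0 < \<eta>" "\<eta> < 1 / (2 * chain_rate \<epsilon> (Suc q))" and f: "f \<in> Lip1 (chain_weight \<epsilon>)"
  have lip: "\<bar>f (Suc n) - f n\<bar> \<le> 1" for n
    by (rule chain.Lip1_adj[OF f]) (simp add: adj_chain_weight)
  define s where "s = 1 - (f (Suc q) - f (Suc (Suc q)))"
  have s: "s \<ge> 0"
    using lip[of "Suc q"] by (simp add: s_def)
  have "laplacian (chain_weight \<epsilon>) (\<lambda>_. 1) f (Suc q) - laplacian (chain_weight \<epsilon>) (\<lambda>_. 1) f (Suc (Suc q))
      = 2 * a (Suc q) * (s - 1) + a q * (f q - f (Suc q))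
        + a (Suc (Suc q)) * (f (Suc (Suc q)) - f (Suc (Suc (Suc q))))"
    by (simp add: laplacian_chain_Suc a_def s_def algebra_simps)
  also have "\<dots> \<le> 2 * a (Suc q) * (s - 1) + a q * 1 + a (Suc (Suc q)) * 1"
    using lip[of q] lip[of "Suc (Suc q)"]
    by (intro add_mono mult_left_mono order_refl less_imp_le[OF a]) linarith+
  \<comment> \<open>Differencing the double sum in \<open>chain_rate\<close> twice leaves just its
    term with \<open>k = Suc (Suc q)\<close>.\<close>
  also have "\<dots> = 2 * a (Suc q) * s + ln (real (Suc (Suc q))) powr (1 + \<epsilon>)"
    unfolding a_def chain_rate_Suc by (simp add: algebra_simps)
  finally have "\<eta> * (laplacian (chain_weight \<epsilon>) (\<lambda>_. 1) f (Suc q)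
        - laplacian (chain_weight \<epsilon>) (\<lambda>_. 1) f (Suc (Suc q)))
      \<le> \<eta> * (2 * a (Suc q) * s + ln (real (Suc (Suc q))) powr (1 + \<epsilon>))"
    using \<eta>(1) by (intro mult_left_mono) auto
  \<comment> \<open>Here the threshold on \<open>\<eta>\<close> enters: the gain from the deficit
    \<open>s\<close> is at most the loss \<open>s\<close> itself.\<close>
  moreover have "\<eta> * (2 * a (Suc q)) * s \<le> 1 * s"
    using \<eta> s a[of "Suc q"] by (intro mult_right_mono) (simp_all add: a_def field_simps)
  ultimately show "\<eta> * - (ln (real (Suc (Suc q))) powr (1 + \<epsilon>))
      \<le> 1 - (f (Suc q) - f (Suc (Suc q)))
        - \<eta> * (laplacian (chain_weight \<epsilon>) (\<lambda>_. 1) f (Suc q)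
            - laplacian (chain_weight \<epsilon>) (\<lambda>_. 1) f (Suc (Suc q)))"
    by (simp add: s_def[symmetric] distrib_left mult.assoc)
qed

lemma sphere_curvature_chain_ge:
  assumes "r \<ge> 2"
  shows "sphere_curvature (chain_weight \<epsilon>) (\<lambda>_. 1) 0 r \<ge> ereal (- (ln (real r) powr (1 + \<epsilon>)))"
proof -
  have "r = Suc (Suc (r - 2))"
    using assms by simp
  then obtain q where q: "r = Suc (Suc q)"
    by blast
  have "gsphere (chain_weight \<epsilon>) 0 n = {n}" for n
    by (auto simp: gsphere_def gdist_chain)
  moreover have "{x \<in> {Suc q}. adj (chain_weight \<epsilon>) x (Suc (Suc q))} = {Suc q}"
    by (auto simp: adj_chain_weight)
  ultimately have "sphere_curvature (chain_weight \<epsilon>) (\<lambda>_. 1) 0 r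
      = ereal (curvature (chain_weight \<epsilon>) (\<lambda>_. 1) (Suc q) (Suc (Suc q)))"
    by (simp add: sphere_curvature_def q)
  then show ?thesis
    using curvature_chain_ge[of q \<epsilon>] by (simp add: q)
qed

section \<open>Growth of the rates and convergence of the series\<close>

lemma summable_inverse_mult_ln_powr:
  fixes p :: real
  assumes "p > 1"
  shows "summable (\<lambda>n. 1 / (real n * ln (real n + 1) powr p))"
proof (subst condensation_test)
  \<comment> \<open>The term at 0 is 0 by division by zero, so monotonicity starts at 1. The shift
    inside the logarithm keeps the term at 1 meaningful.\<close>
  fix n :: nat assume "0 < n"
  then show "1 / (real (Suc n) * ln (real (Suc n) + 1) powr p) \<le> 1 / (real n * ln (real n + 1) powr p)"
    using assms by (intro divide_left_mono mult_mono powr_mono2 ln_mono mult_pos_pos) auto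
next
  show "summable (\<lambda>n. 2 ^ n * (1 / (real (2 ^ n) * ln (real (2 ^ n) + 1) powr p)))"
  proof (rule summable_comparison_test')
    show "summable (\<lambda>n. (1 / ln 2 powr p) * real n powr - p)"
      using assms by (intro summable_mult) (simp add: summable_real_powr_iff)
    fix n :: nat assume "1 \<le> n"
    \<comment> \<open>At powers of 2 the logarithm is at least linear in \<open>n\<close>, so
      condensation is dominated by a p-series with \<open>p > 1\<close>.\<close>
    have "real n * ln 2 = ln (2 ^ n)"
      by (simp add: ln_realpow)
    also have "\<dots> \<le> ln (2 ^ n + 1)"
      by (intro ln_mono) auto
    finally have "real n * ln 2 \<le> ln (2 ^ n + 1)" .
    then have "(real n * ln 2) powr p \<le> ln (2 ^ n + 1) powr p"
      using assms by (intro powr_mono2) auto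
    moreover have "0 < (real n * ln 2) powr p"
      using \<open>1 \<le> n\<close> by simp
    ultimately have "1 / ln (2 ^ n + 1) powr p \<le> 1 / (real n * ln 2) powr p"
      by (intro divide_left_mono mult_pos_pos) auto
    then show "norm (2 ^ n * (1 / (real (2 ^ n) * ln (real (2 ^ n) + 1) powr p)))
        \<le> (1 / ln 2 powr p) * real n powr - p"
      by (simp add: powr_mult powr_minus field_simps)
  qed
qed auto

text \<open>With \<open>n\<close> about \<open>R / 4\<close>, only \<open>r\<close> in
  \<open>{2 * n + 1..4 * n}\<close> and \<open>k\<close> in \<open>{n + 1..2 * n}\<close> are kept:
  these are \<open>2 * n * n\<close> terms, each at least the one with
  \<open>k = n + 1\<close>.\<close>

lemma chain_rate_ge:
  assumes "\<epsilon> > 0" "R \<ge> 16"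
  shows "chain_rate \<epsilon> R \<ge> (real R + 1) ^ 2 / 32 * (ln (real R + 2) / 2) powr (1 + \<epsilon>)"
proof -
  define n where "n = R div 4"
  have n: "4 \<le> n" "R \<le> 4 * n + 3" "4 * n \<le> R"
    using assms(2) unfolding n_def by presburger+
  define l where "l k = ln (real k) powr (1 + \<epsilon>)" for k
  have "real R \<le> real (4 * n + 3)" "4 \<le> real n"
    using n(1,2) by (simp_all only: of_nat_le_iff numeral_le_real_of_nat_iff)
  then have R: "4 \<le> real n" "real R \<le> 4 * real n + 3"
    by simp_all
  \<comment> \<open>From \<open>n \<ge> 4\<close> follows \<open>R + 2 \<le> (n + 1)^2\<close>,
    which costs only a factor 2 in the logarithm.\<close>
  then have "real R + 2 \<le> 5 * (real n + 1)"
    by argo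
  also have "\<dots> \<le> (real n + 1) * (real n + 1)"
    using n by (intro mult_right_mono) auto
  finally have "ln (real R + 2) \<le> ln ((real n + 1) ^ 2)"
    by (intro ln_mono) (auto simp: power2_eq_square)
  also have "\<dots> = 2 * ln (real n + 1)"
    by (simp add: ln_realpow)
  finally have ln_le: "(ln (real R + 2) / 2) powr (1 + \<epsilon>) \<le> l (n + 1)"
    using assms(1) unfolding l_def by (intro powr_mono2) (auto simp: add.commute)
  have "(real R + 1) / 8 \<le> real n"
    using R by argo
  then have "((real R + 1) / 8) ^ 2 \<le> real n ^ 2"
    by (intro power_mono) auto
  then have "(real R + 1) ^ 2 / 32 \<le> 2 * real n * real n"
    by (simp add: power2_eq_square)
  then have "(real R + 1) ^ 2 / 32 * (ln (real R + 2) / 2) powr (1 + \<epsilon>) \<le> 2 * real n * real n * l (n + 1)"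
    using ln_le by (intro mult_mono) auto
  also have "\<dots> = real (card {2 * n + 1..4 * n}) * (real (card {n + 1..2 * n}) * l (n + 1))"
    by simp
  also have "\<dots> \<le> (\<Sum>r=2 * n + 1..4 * n. \<Sum>k=1..r. l k)"
  proof (rule sum_bounded_below)
    fix r assume r: "r \<in> {2 * n + 1..4 * n}"
    have "real (card {n + 1..2 * n}) * l (n + 1) \<le> (\<Sum>k=n + 1..2 * n. l k)"
    proof (rule sum_bounded_below)
      fix k assume "k \<in> {n + 1..2 * n}"
      then show "l (n + 1) \<le> l k"
        using assms(1) unfolding l_def by (intro powr_mono2 ln_mono) auto
    qed
    also have "\<dots> \<le> (\<Sum>k=1..r. l k)"
      using r by (intro sum_mono2) (auto simp: l_def)
    finally show "real (card {n + 1..2 * n}) * l (n + 1) \<le> (\<Sum>k=1..r. l k)" .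
  qed
  also have "\<dots> \<le> (\<Sum>r=1..R. \<Sum>k=1..r. l k)"
    using n by (intro sum_mono2 sum_nonneg) (auto simp: l_def)
  also have "\<dots> \<le> chain_rate \<epsilon> R"
    by (simp add: chain_rate_def l_def)
  finally show ?thesis .
qed

lemma summable_Suc_div_chain_rate:
  assumes "\<epsilon> > 0"
  shows "summable (\<lambda>R. (real R + 1) / chain_rate \<epsilon> R)"
proof (rule summable_comparison_test')
  define c where "c = 32 * 2 powr (1 + \<epsilon>)"
  have "summable (\<lambda>R. 1 / (real (Suc R) * ln (real (Suc R) + 1) powr (1 + \<epsilon>)))"
    using summable_inverse_mult_ln_powr[of "1 + \<epsilon>"] assms by (subst summable_Suc_iff) auto
  then show "summable (\<lambda>R. c * (1 / (real (Suc R) * ln (real (Suc R) + 1) powr (1 + \<epsilon>))))"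
    by (rule summable_mult)
  fix R :: nat assume R: "16 \<le> R"
  define L where "L = ln (real R + 2) powr (1 + \<epsilon>)"
  have L: "L > 0"
    by (simp add: L_def)
  have "(real R + 1) ^ 2 * L / c = (real R + 1) ^ 2 / 32 * (ln (real R + 2) / 2) powr (1 + \<epsilon>)"
    by (simp add: L_def c_def powr_divide)
  also have "\<dots> \<le> chain_rate \<epsilon> R"
    by (rule chain_rate_ge[OF assms R])
  finally have "(real R + 1) / chain_rate \<epsilon> R \<le> (real R + 1) / ((real R + 1) ^ 2 * L / c)"
    using L chain_rate_pos[of \<epsilon> R]
    by (intro divide_left_mono mult_pos_pos) (auto simp: c_def)
  also have "\<dots> = c * (1 / ((real R + 1) * L))"
    by (simp add: power2_eq_square)
  finally show "norm ((real R + 1) / chain_rate \<epsilon> R)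
      \<le> c * (1 / (real (Suc R) * ln (real (Suc R) + 1) powr (1 + \<epsilon>)))"
    using chain_rate_pos[of \<epsilon> R] by (simp add: L_def add.commute)
qed

text \<open>
  With \<open>\<beta> R = \<Sum>k<R. (k + 1) / w(k, k + 1)\<close> bounded by \<open>S\<close> and \<open>\<Delta> \<beta> = 1\<close>, the function
  \<open>1 - (t + \<beta> - S) / (S + 1)\<close> solves the heat equation, is non-negative up to time \<open>S + 1\<close>, starts
  above \<open>1\<close> and ends below \<open>1\<close>.
\<close>

lemma not_stochastically_complete_chain:
  assumes "\<epsilon> > 0"
  shows "\<not> stochastically_complete (chain_weight \<epsilon>) (\<lambda>_. 1)"
proof
  assume complete: "stochastically_complete (chain_weight \<epsilon>) (\<lambda>_. 1)"
  define q where "q k = (real k + 1) / chain_rate \<epsilon> k" for k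
  define \<beta> where "\<beta> R = (\<Sum>k<R. q k)" for R
  define S where "S = suminf q"
  define T where "T = S + 1"
  define v where "v x t = 1 - (t + \<beta> x - S) / T" for x t
  have q: "q k \<ge> 0" for k
    using chain_rate_pos[of \<epsilon> k] by (simp add: q_def)
  have summable: "summable q"
    using summable_Suc_div_chain_rate[OF assms] by (simp add: q_def[abs_def])
  have S: "S \<ge> 0" "\<And>R. \<beta> R \<le> S"
    unfolding S_def \<beta>_def using q summable by (auto intro: suminf_nonneg sum_le_suminf)
  have \<beta>: "\<beta> R \<ge> 0" for R
    using q by (simp add: \<beta>_def sum_nonneg)
  have T: "T > 0"
    using S by (simp add: T_def)
  have rate_q: "chain_rate \<epsilon> k * q k = real k + 1" for k
    using chain_rate_pos[of \<epsilon> k] by (simp add: q_def)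
  \<comment> \<open>The flux of \<beta> through the edge from \<open>k\<close> to
    \<open>k + 1\<close> is \<open>k + 1\<close>, so outgoing minus incoming flux is 1 at every
    vertex, including 0.\<close>
  have lap_\<beta>: "laplacian (chain_weight \<epsilon>) (\<lambda>_. 1) \<beta> x = 1" for x
    by (cases x) (simp_all add: laplacian_chain_0 laplacian_chain_Suc \<beta>_def rate_q)
  have lap_v: "laplacian (chain_weight \<epsilon>) (\<lambda>_. 1) (\<lambda>y. v y s) x = - 1 / T" for x s
  proof -
    have "laplacian (chain_weight \<epsilon>) (\<lambda>_. 1) (\<lambda>y. v y s) x
        = laplacian (chain_weight \<epsilon>) (\<lambda>_. 1) (\<lambda>y. (- 1 / T) * \<beta> y) x"
      using T by (intro chain.laplacian_cong) (simp add: v_def field_simps)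
    then show ?thesis
      by (simp only: chain.laplacian_cmult lap_\<beta>)
  qed
  \<comment> \<open>Comparison is made only up to \<open>T\<close>, since \<open>v\<close> becomes
    negative at later times. As \<open>\<beta> 0 = 0\<close>, the value \<open>v 0 T\<close> is
    \<open>1 - 1 / T\<close>.\<close>
  have "chain.feller_limit \<epsilon> (\<lambda>_. 1) 0 T \<le> v 0 T"
  proof (rule chain.feller_limit_le[where B = 1 and T = T])
    show "v y 0 \<ge> 1" for y
      using S(2)[of y] T by (simp add: v_def divide_nonpos_pos)
    show "v y s \<ge> 0" if "0 \<le> s" "s \<le> T" for y s
      using S(2)[of y] that T by (simp add: v_def field_simps)
    show "(v y has_real_derivative laplacian (chain_weight \<epsilon>) (\<lambda>_. 1) (\<lambda>z. v z s) y) (at s within {0..})"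
      for y s
      unfolding lap_v unfolding v_def[abs_def] using T by (auto intro!: derivative_eq_intros)
  qed (use T in auto)
  also have "\<dots> < 1"
    using T by (simp add: v_def \<beta>_def T_def)
  also have "1 = heat_semigroup (chain_weight \<epsilon>) (\<lambda>_. 1) T (\<lambda>_. 1) 0"
    using complete T by (simp add: stochastically_complete_def)
  also have "\<dots> = chain.feller_limit \<epsilon> (\<lambda>_. 1) 0 T"
    using T by (intro chain.heat_semigroup_eqI chain.minimal_heat_solution_feller_limit[of _ 1]) auto
  finally show False by simp
qed

theorem theorem4p11:
  "(\<forall>(w :: 'v::countable \<Rightarrow> 'v \<Rightarrow> real) m x0 C.
      weighted_graph w m \<longrightarrow> C > 0 \<longrightarrow>
      (\<forall>\<^sub>F r in sequentially. sphere_curvature w m x0 r \<ge> ereal (- C * ln (real r))) \<longrightarrow>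
      stochastically_complete w m) \<and>
   (\<forall>\<epsilon>>0.
      \<not> stochastically_complete (chain_weight \<epsilon>) (\<lambda>_. 1) \<and>
      (\<forall>r\<ge>2. sphere_curvature (chain_weight \<epsilon>) (\<lambda>_. 1) 0 r
               \<ge> ereal (- (ln (real r) powr (1 + \<epsilon>)))))"
  using weighted_graph.stochastically_complete_if_sphere_curvature_ge
    not_stochastically_complete_chain sphere_curvature_chain_ge by blast

end
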